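(* Let $d\ge1$, let $\alpha\in\mathbb{R}^d$ with $\alpha_i>0$ for all $i$ and $\sum_{i=1}^d\alpha_i=1$, let $\mathcal{K}_{\mathrm{hpower}}$ be the hypograph power cone parametrized by $\alpha$ with barrier $f$, and let $g^\ast$ be its conjugate gradient (all defined in the context). For every $(p,r)\in\operatorname{int}(\mathcal{K}_{\mathrm{hpower}}^\ast)$, the components of $g^\ast=g^\ast(p,r)$ are $$g^\ast_p=-p^{-1}-\hat y^{-1},\qquad g^\ast_{r_i}=\frac{p\,\alpha_i\,\hat y^{-1}-1}{r_i}\quad(i=1,\dots,d),$$ where $\hat y$ is the unique root of the function $h(y)=\sum_{i=1}^d\alpha_i\log(y-p\alpha_i)-\log(\varphi(r))$ (defined for $y>\max_i p\alpha_i$). In the case where $\alpha_i=1/d$ for all $i$, the conjugate gradient at $(p,r)$ can be written as $$g^\ast_p=-p^{-1}-\Bigl(\varphi(r)+\frac pd\Bigr)^{-1},\qquad g^\ast_{r_i}=-\frac{\varphi(r)}{r_i\bigl(\varphi(r)+\frac pd\bigr)}\quad(i=1,\dots,d).$$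
   Context: For a closed, convex, pointed, full-dimensional cone $\mathcal{K}$ in a finite-dimensional real inner product space, the dual cone is $\mathcal{K}^\ast=\{s:\langle w,s\rangle\ge 0\ \forall w\in\mathcal{K}\}$. Given a barrier function $f:\operatorname{int}(\mathcal{K})\to\mathbb{R}$, the conjugate barrier is $f^\ast(s)=\sup_{w\in\operatorname{int}(\mathcal{K})}\{-\langle s,w\rangle-f(w)\}$ for $s\in\operatorname{int}(\mathcal{K}^\ast)$, and the conjugate gradient $g^\ast$ is the gradient of $f^\ast$; equivalently $g^\ast(s)=-\operatorname{argsup}_{w\in\operatorname{int}(\mathcal{K})}\{-\langle s,w\rangle-f(w)\}$. The standard inner product is used. Let $\varphi(w)=\prod_{i=1}^d w_i^{\alpha_i}$. The hypograph power cone is $\mathcal{K}_{\mathrm{hpower}}=\{(u,w)\in\mathbb{R}\times\mathbb{R}^d_+:u\le\varphi(w)\}$ with barrier $f(u,w)=-\log(\varphi(w)-u)-\sum_{i=1}^d\log(w_i)$. Its dual cone is $\mathcal{K}_{\mathrm{hpower}}^\ast=\{(p,r)\in\mathbb{R}_-\times\mathbb{R}^d_+:-p\le\prod_{i=1}^d(r_i/\alpha_i)^{\alpha_i}\}$, where $\mathbb{R}_-$ denotes the nonpositive reals. Subscripts $p,r_i$ on $g^\ast$ denote the corresponding components. *)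

theory Defs
  imports "HOL-Analysis.Analysis"
begin

definition dual_cone :: "'a::real_inner set \<Rightarrow> 'a set" where
  "dual_cone K = {s. \<forall>w\<in>K. 0 \<le> w \<bullet> s}"

(* The supremum is taken in the reals, hence is unspecified if the set is unbounded above;
   bdd_above_hpower_conj below shows that this does not occur on the interior of the dual cone. *)
definition conj_barrier :: "'a::real_inner set \<Rightarrow> ('a \<Rightarrow> real) \<Rightarrow> 'a \<Rightarrow> real" where
  "conj_barrier K f s = (SUP w\<in>interior K. - (s \<bullet> w) - f w)"

(* Meaningful only where the conjugate barrier is differentiable. *)
definition conj_gradient :: "'a::real_inner set \<Rightarrow> ('a \<Rightarrow> real) \<Rightarrow> 'a \<Rightarrow> 'a" where
  "conj_gradient K f s = (THE g. GDERIV (conj_barrier K f) s :> g)"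

definition power_prod :: "real ^ 'n \<Rightarrow> real ^ 'n \<Rightarrow> real" where
  "power_prod \<alpha> w = (\<Prod>i\<in>UNIV. (w $ i) powr (\<alpha> $ i))"

definition hpower_cone :: "real ^ 'n \<Rightarrow> (real \<times> (real ^ 'n)) set" where
  "hpower_cone \<alpha> = {(u, w). (\<forall>i. 0 \<le> w $ i) \<and> u \<le> power_prod \<alpha> w}"

(* Only the values on the interior of the cone, where all logarithms have positive
   arguments, are relevant. *)
definition hpower_barrier :: "real ^ 'n \<Rightarrow> real \<times> (real ^ 'n) \<Rightarrow> real" where
  "hpower_barrier \<alpha> = (\<lambda>(u, w). - ln (power_prod \<alpha> w - u) - (\<Sum>i\<in>UNIV. ln (w $ i)))"

definition hpower_h :: "real ^ 'n \<Rightarrow> real \<Rightarrow> real ^ 'n \<Rightarrow> real \<Rightarrow> real" where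
  "hpower_h \<alpha> p r y = (\<Sum>i\<in>UNIV. \<alpha> $ i * ln (y - p * \<alpha> $ i)) - ln (power_prod \<alpha> r)"

lemma interior_dual_cone_coercive:
  fixes s :: "'a::real_inner"
  assumes "s \<in> interior (dual_cone K)"
  obtains e where "e > 0" "\<And>w. w \<in> K \<Longrightarrow> e * norm w \<le> s \<bullet> w"
proof -
  obtain e where e: "e > 0" "cball s e \<subseteq> dual_cone K"
    using assms by (auto simp: mem_interior_cball)
  have "e * norm w \<le> s \<bullet> w" if w: "w \<in> K" for w
  proof (cases "w = 0")
    case False
    have "s - (e / norm w) *\<^sub>R w \<in> cball s e"
      using e(1) False by (simp add: dist_norm)
    then have "0 \<le> w \<bullet> (s - (e / norm w) *\<^sub>R w)"
      using e(2) w unfolding dual_cone_def by blast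
    also have "\<dots> = s \<bullet> w - e / norm w * (norm w * norm w)"
      by (simp add: inner_diff_right inner_commute power2_eq_square flip: power2_norm_eq_inner)
    finally show ?thesis using False by simp
  qed simp
  then show thesis using e(1) that by blast
qed

lemma interior_hpower_coneD:
  fixes \<alpha> w :: "real ^ 'n"
  assumes "(u, w) \<in> interior (hpower_cone \<alpha>)"
  shows "u < power_prod \<alpha> w" "0 < w $ i"
proof -
  obtain e where e: "e > 0" "cball (u, w) e \<subseteq> hpower_cone \<alpha>"
    using assms by (auto simp: mem_interior_cball)
  have "(u + e, w) \<in> cball (u, w) e" "(u, w - e *\<^sub>R axis i 1) \<in> cball (u, w) e"
    using e(1) by (simp_all add: dist_Pair_Pair dist_norm norm_axis_1)
  then have "(u + e, w) \<in> hpower_cone \<alpha>" "(u, w - e *\<^sub>R axis i 1) \<in> hpower_cone \<alpha>"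
    using e(2) by auto
  then have "u + e \<le> power_prod \<alpha> w" "0 \<le> (w - e *\<^sub>R axis i 1) $ i"
    unfolding hpower_cone_def by blast+
  then show "u < power_prod \<alpha> w" "0 < w $ i"
    using e(1) by (auto simp: axis_def)
qed

lemma power_prod_le_norm:
  fixes \<alpha> w :: "real ^ 'n"
  assumes "\<And>i. 0 < \<alpha> $ i" "(\<Sum>i\<in>UNIV. \<alpha> $ i) = 1" "\<And>i. 0 < w $ i"
  shows "power_prod \<alpha> w \<le> norm w"
proof -
  have w0: "norm w > 0"
    using assms(3) by (metis less_irrefl zero_index zero_less_norm_iff)
  have "power_prod \<alpha> w \<le> (\<Prod>i\<in>(UNIV::'n set). norm w powr (\<alpha> $ i))"
    unfolding power_prod_def
    by (intro prod_mono conjI powr_mono2)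
       (use assms(1,3) component_le_norm_cart[of w] in \<open>auto intro: less_imp_le order_trans[OF abs_ge_self]\<close>)
  also have "\<dots> = norm w"
    using w0 assms(2) by (simp flip: powr_sum)
  finally show ?thesis .
qed

lemma bdd_above_hpower_conj:
  fixes \<alpha> :: "real ^ 'n"
  assumes "\<And>i. 0 < \<alpha> $ i" "(\<Sum>i\<in>UNIV. \<alpha> $ i) = 1"
    and "s \<in> interior (dual_cone (hpower_cone \<alpha>))"
  shows "bdd_above ((\<lambda>w. - (s \<bullet> w) - hpower_barrier \<alpha> w) ` interior (hpower_cone \<alpha>))"
proof -
  obtain e where e: "e > 0" "\<And>x. x \<in> hpower_cone \<alpha> \<Longrightarrow> e * norm x \<le> s \<bullet> x"
    using interior_dual_cone_coercive[OF assms(3)] by blast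
  define D where "D = real CARD('n) + 1"
  define c where "c = e / D"
  have D: "D > 0" and c: "c > 0" and cD: "D * c = e"
    using e(1) by (simp_all add: D_def c_def add_pos_pos)
  have "- (s \<bullet> x) - hpower_barrier \<alpha> x \<le> ln 2 + D * (- 1 - ln c)"
    if x: "x \<in> interior (hpower_cone \<alpha>)" for x
  proof -
    obtain u w where uw: "x = (u, w)" by (cases x)
    have I: "u < power_prod \<alpha> w" "\<And>i. 0 < w $ i"
      using interior_hpower_coneD x uw by blast+
    define N where "N = norm x"
    have N: "norm w \<le> N" "\<bar>u\<bar> \<le> N"
      using norm_snd_le[of w u] norm_fst_le[of u w] by (simp_all add: uw N_def)
    have wi: "w $ i \<le> N" for i
      using component_le_norm_cart[of w i] N(1) by linarith
    have N0: "N > 0" using wi I(2) by (meson less_le_trans)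
    have "ln (power_prod \<alpha> w - u) \<le> ln (2 * N)"
      using power_prod_le_norm[OF assms(1,2) I(2)] N I(1) N0 by (subst ln_le_cancel_iff) auto
    then have 1: "ln (power_prod \<alpha> w - u) \<le> ln 2 + ln N"
      using N0 by (simp add: ln_mult)
    have "(\<Sum>i\<in>(UNIV::'n set). ln (w $ i)) \<le> (\<Sum>i\<in>(UNIV::'n set). ln N)"
      using wi I(2) N0 by (intro sum_mono) auto
    then have 2: "(\<Sum>i\<in>UNIV. ln (w $ i)) \<le> real CARD('n) * ln N" by simp
    have "ln (c * N) \<le> c * N - 1"
      using N0 c by (intro ln_le_minus_one) auto
    then have "ln N \<le> c * N - 1 - ln c"
      using N0 c by (simp add: ln_mult)
    then have "D * ln N \<le> D * (c * N - 1 - ln c)"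
      using D by (intro mult_left_mono) auto
    also have "\<dots> = e * N + D * (- 1 - ln c)"
      by (simp add: algebra_simps flip: cD)
    finally have 3: "D * ln N \<le> e * N + D * (- 1 - ln c)" .
    have 4: "e * N \<le> s \<bullet> x"
      using e(2) x interior_subset unfolding N_def by blast
    have "D * ln N = real CARD('n) * ln N + ln N"
      by (simp add: D_def algebra_simps)
    then show ?thesis using 1 2 3 4 by (simp add: uw hpower_barrier_def)
  qed
  then show ?thesis by (rule bdd_aboveI2)
qed

end

theory Submission
  imports Defs
begin

text \<open>
  The supremum that defines the conjugate barrier is attained, at a point \<open>x(s)\<close> that depends
  continuously on \<open>s = (p, r)\<close>; by an envelope argument (\<open>GDERIV_conj_barrier\<close>) the conjugate
  barrier is then differentiable with gradient \<open>- x(s)\<close>. It remains to find \<open>x(s)\<close>.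

  Setting the derivatives of \<open>- p u - \<langle>r, w\<rangle> - f(u, w)\<close> to zero gives \<open>\<phi>(w) - u = - 1 / p\<close> and
  \<open>r\<^sub>i w\<^sub>i = 1 - p \<alpha>\<^sub>i \<phi>(w)\<close>. With \<open>y = 1 / \<phi>(w)\<close> this determines \<open>u\<close> and \<open>w\<close> in terms of \<open>y\<close>,
  and the consistency condition \<open>\<phi>(w) = 1 / y\<close> is exactly \<open>h(y) = 0\<close>
  (\<open>hpower_root_reciprocal\<close>). That this critical point is a global maximiser follows from
  global bounds that are tight there (\<open>hpower_argmax_maximal\<close>): each logarithm in the barrier is bounded by its
  tangent at the critical point, and \<open>\<phi>\<close> is bounded by the weighted inequality between the
  arithmetic and the geometric mean; the linear terms then cancel.

  The function \<open>h\<close> is strictly increasing. Membership of \<open>(p, r)\<close> in the interior of the dual cone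
  forces \<open>p < 0 < r\<^sub>i\<close> and \<open>h(0) < 0\<close>, while \<open>h(\<phi>(r)) \<ge> 0\<close>, so there is exactly one root and it is
  positive. Because the sign change of \<open>h\<close> around the root survives small changes of
  \<open>(p, r)\<close>, the root is continuous in \<open>(p, r)\<close> (\<open>tendsto_hpower_root\<close>), and hence so is \<open>x\<close>.
\<close>

section \<open>The gradient of a conjugate barrier\<close>

text \<open>
  Comparing the maximisers \<open>x s\<close> and \<open>x t\<close> in each other's problems squeezes
  \<open>f\<^sup>* t - f\<^sup>* s + \<langle>t - s, x s\<rangle>\<close> between \<open>0\<close> and \<open>- \<langle>t - s, x t - x s\<rangle>\<close>, and the latter is
  of smaller order than \<open>t - s\<close> by continuity of \<open>x\<close>.
\<close>
lemma GDERIV_conj_barrier: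
  fixes x :: "'a::real_inner \<Rightarrow> 'a"
  assumes S: "open S" "s \<in> S"
    and feasible: "\<And>t. t \<in> S \<Longrightarrow> x t \<in> interior K"
    and maximal: "\<And>t w. t \<in> S \<Longrightarrow> w \<in> interior K \<Longrightarrow> - (t \<bullet> w) - f w \<le> - (t \<bullet> x t) - f (x t)"
    and cont: "(x \<longlongrightarrow> x s) (at s)"
  shows "GDERIV (conj_barrier K f) s :> - x s"
proof -
  have val: "conj_barrier K f t = - (t \<bullet> x t) - f (x t)" if "t \<in> S" for t
    unfolding conj_barrier_def using feasible maximal that
    by (intro cSup_eq_maximum) auto
  obtain e where e: "e > 0" "ball s e \<subseteq> S"
    using S open_contains_ball by blast
  have "(conj_barrier K f has_derivative (\<lambda>h. h \<bullet> (- x s))) (at s within UNIV)"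
  proof (rule has_derivativeI_sandwich[where H = "\<lambda>t. norm (x t - x s)"])
    show "0 < e" by fact
    show "bounded_linear (\<lambda>h. h \<bullet> - x s)"
      by (rule bounded_linear_inner_left)
    show "((\<lambda>t. norm (x t - x s)) \<longlongrightarrow> 0) (at s)"
      using cont by (simp add: LIM_zero tendsto_norm_zero)
    fix t assume t: "t \<noteq> s" "dist t s < e"
    then have "t \<in> S" using e by (auto simp: dist_commute)
    define D where "D = conj_barrier K f t - conj_barrier K f s - (t - s) \<bullet> (- x s)"
    have "- (t \<bullet> x s) - f (x s) \<le> - (t \<bullet> x t) - f (x t)"
      "- (s \<bullet> x t) - f (x t) \<le> - (s \<bullet> x s) - f (x s)"
      using maximal feasible S \<open>t \<in> S\<close> by auto
    then have "0 \<le> D" "D \<le> - ((t - s) \<bullet> (x t - x s))"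
      by (simp_all add: D_def val S \<open>t \<in> S\<close> inner_diff_left inner_diff_right)
    then have "norm D \<le> norm (t - s) * norm (x t - x s)"
      using Cauchy_Schwarz_ineq2[of "t - s" "x t - x s"] by simp
    then show "norm (conj_barrier K f t - conj_barrier K f s - (t - s) \<bullet> (- x s)) / norm (t - s)
        \<le> norm (x t - x s)"
      using t(1) by (simp add: D_def divide_le_eq mult.commute)
  qed
  then show ?thesis by (simp add: gderiv_def)
qed

lemma conj_gradient_eq:
  assumes "GDERIV (conj_barrier K f) s :> g"
  shows "conj_gradient K f s = g"
  unfolding conj_gradient_def
proof (rule the_equality)
  fix g' assume "GDERIV (conj_barrier K f) s :> g'"
  then have "(\<lambda>h. h \<bullet> g') = (\<lambda>h. h \<bullet> g)"
    using assms has_derivative_unique unfolding gderiv_def by blast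
  then show "g' = g"
    by (metis vector_eq_ldot)
qed fact

section \<open>Weighted geometric means and the cone\<close>

lemma power_prod_pos:
  assumes "\<And>i. 0 < w $ i"
  shows "0 < power_prod \<alpha> w"
  unfolding power_prod_def using assms by (intro prod_pos) (simp add: less_imp_neq[THEN not_sym])

lemma ln_power_prod:
  assumes "\<And>i. 0 < w $ i"
  shows "ln (power_prod \<alpha> w) = (\<Sum>i\<in>UNIV. \<alpha> $ i * ln (w $ i))"
  unfolding power_prod_def using assms
  by (subst ln_prod) (auto simp: ln_powr less_imp_neq[THEN not_sym])

lemma tendsto_power_prod:
  assumes "\<And>i. 0 < w $ i" "(v \<longlongrightarrow> w) F"
  shows "((\<lambda>t. power_prod \<alpha> (v t)) \<longlongrightarrow> power_prod \<alpha> w) F"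
  unfolding power_prod_def using assms
  by (intro tendsto_prod tendsto_powr tendsto_vec_nth tendsto_const) (auto simp: less_imp_neq[THEN not_sym])

lemma interior_hpower_coneI:
  assumes "\<And>i. 0 < w $ i" "u < power_prod \<alpha> w"
  shows "(u, w) \<in> interior (hpower_cone \<alpha>)"
proof -
  have lim: "((\<lambda>x. snd x $ i) \<longlongrightarrow> w $ i) (nhds (u, w))"
    "((\<lambda>x. power_prod \<alpha> (snd x) - fst x) \<longlongrightarrow> power_prod \<alpha> w - u) (nhds (u, w))" for i
    using tendsto_fst[OF filterlim_ident, of "(u,w)"] tendsto_snd[OF filterlim_ident, of "(u,w)"]
    by (auto intro!: tendsto_intros tendsto_power_prod assms)
  have "\<forall>\<^sub>F x in nhds (u, w). \<forall>i. 0 < snd x $ i"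
    using lim(1) assms by (intro eventually_all_finite order_tendstoD(1))
  moreover have "\<forall>\<^sub>F x in nhds (u, w). 0 < power_prod \<alpha> (snd x) - fst x"
    using lim(2) assms by (intro order_tendstoD(1)) auto
  ultimately have "\<forall>\<^sub>F x in nhds (u, w). x \<in> hpower_cone \<alpha>"
    by eventually_elim (auto simp: hpower_cone_def less_imp_le)
  then show ?thesis
    by (auto simp: eventually_nhds interior_def)
qed

text \<open>
  The weighted inequality between the arithmetic and the geometric mean: take the weighted sum of
  the tangent bounds of \<open>ln\<close> at the arithmetic mean \<open>A\<close>, whose linear parts average out to \<open>0\<close>.
\<close>
lemma power_prod_le_weighted_sum:
  fixes \<alpha> t :: "real ^ 'n"
  assumes \<alpha>: "\<And>i. 0 < \<alpha> $ i" "(\<Sum>i\<in>UNIV. \<alpha> $ i) = 1" and t: "\<And>i. 0 < t $ i"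
  shows "power_prod \<alpha> t \<le> (\<Sum>i\<in>UNIV. \<alpha> $ i * t $ i)"
proof -
  define A where "A = (\<Sum>i\<in>UNIV. \<alpha> $ i * t $ i)"
  have A: "A > 0" unfolding A_def using \<alpha> t by (intro sum_pos) auto
  have "ln (t $ i) \<le> ln A + (t $ i / A - 1)" for i
    using ln_le_minus_one[of "t $ i / A"] t[of i] A by (simp add: ln_div)
  then have "ln (power_prod \<alpha> t) \<le> (\<Sum>i\<in>UNIV. \<alpha> $ i * (ln A + (t $ i / A - 1)))"
    unfolding ln_power_prod[OF t] using \<alpha>(1) by (intro sum_mono mult_left_mono) (auto intro: less_imp_le)
  also have "\<dots> = (\<Sum>i\<in>UNIV. \<alpha> $ i) * (ln A - 1) + A / A"
    unfolding A_def sum_divide_distrib sum_distrib_right sum.distrib[symmetric]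
    by (intro sum.cong) (simp_all add: algebra_simps)
  also have "\<dots> = ln A" using A \<alpha>(2) by simp
  finally show ?thesis using A power_prod_pos[OF t, of \<alpha>] by (simp add: A_def)
qed

section \<open>The function h and its root\<close>

text \<open>
  An interior point of the dual cone pairs strictly positively with every nonzero point of the
  cone. The three facts come from three test points: \<open>(-1, 0)\<close>, \<open>(0, e\<^sub>i)\<close>, and the boundary point
  \<open>(\<phi>(w), w)\<close> with \<open>w\<^sub>i = \<alpha>\<^sub>i / r\<^sub>i\<close>. The last one yields
  \<open>- p \<phi>(w) < 1\<close>, the strict form of the inequality that describes the dual cone, and
  \<open>h(0) < 0\<close> is its logarithm.
\<close>
lemma interior_dual_hpower_coneD:
  fixes \<alpha> r :: "real ^ 'n"
  assumes \<alpha>: "\<And>i. 0 < \<alpha> $ i" "(\<Sum>i\<in>UNIV. \<alpha> $ i) = 1"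
    and s: "(p, r) \<in> interior (dual_cone (hpower_cone \<alpha>))"
  shows "p < 0" "0 < r $ i" "hpower_h \<alpha> p r 0 < 0"
proof -
  obtain e where e: "e > 0" "\<And>x. x \<in> hpower_cone \<alpha> \<Longrightarrow> e * norm x \<le> (p, r) \<bullet> x"
    using interior_dual_cone_coercive[OF s] by blast
  have nonneg: "0 \<le> power_prod \<alpha> w" for w
    unfolding power_prod_def by (intro prod_nonneg) auto
  have pos: "0 < (p, r) \<bullet> x" if "x \<in> hpower_cone \<alpha>" "x \<noteq> 0" for x
    using e that by (smt (verit) mult_pos_pos zero_less_norm_iff)
  have "(-1, 0) \<in> hpower_cone \<alpha>"
    using nonneg[of 0] by (auto simp: hpower_cone_def)
  from pos[OF this] show p: "p < 0" by (simp add: prod_eq_iff)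
  have r: "0 < r $ j" for j
  proof -
    have "(0, axis j 1) \<in> hpower_cone \<alpha>"
      using nonneg by (auto simp: hpower_cone_def axis_def)
    from pos[OF this] show ?thesis
      by (simp add: inner_axis prod_eq_iff axis_eq_0_iff)
  qed
  then show "0 < r $ i" .
  define w where "w = (\<chi> i. \<alpha> $ i / r $ i)"
  have w: "0 < w $ i" for i using \<alpha> r by (simp add: w_def)
  have "(power_prod \<alpha> w, w) \<in> hpower_cone \<alpha>"
    using w by (auto simp: hpower_cone_def less_imp_le)
  moreover have "w \<noteq> 0" using w by (metis less_irrefl zero_index)
  moreover have "r \<bullet> w = 1"
    using r \<alpha> by (simp add: inner_vec_def w_def less_imp_neq[THEN not_sym])
  ultimately have "- p * power_prod \<alpha> w < 1"
    using pos[of "(power_prod \<alpha> w, w)"] by (simp add: prod_eq_iff)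
  then have "ln (- p * power_prod \<alpha> w) < 0"
    using p power_prod_pos[OF w, of \<alpha>] by (simp add: mult_neg_pos)
  then have "ln (- p) + ln (power_prod \<alpha> w) < 0"
    using p power_prod_pos[OF w, of \<alpha>] by (subst (asm) ln_mult) auto
  moreover have "ln (- p) + ln (power_prod \<alpha> w) =
      (\<Sum>i\<in>UNIV. \<alpha> $ i) * ln (- p) + (\<Sum>i\<in>UNIV. \<alpha> $ i * ln (w $ i))"
    by (simp add: ln_power_prod[OF w] \<alpha>(2))
  moreover have "\<dots> = hpower_h \<alpha> p r 0"
    unfolding hpower_h_def ln_power_prod[OF r] sum_distrib_right
      sum.distrib[symmetric] sum_subtractf[symmetric]
  proof (intro sum.cong refl)
    fix i
    have "ln (0 - p * \<alpha> $ i) = ln (- p) + ln (\<alpha> $ i)"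
      using p \<alpha>(1)[of i] ln_mult[of "- p" "\<alpha> $ i"] by simp
    moreover have "ln (w $ i) = ln (\<alpha> $ i) - ln (r $ i)"
      using r[of i] \<alpha>(1)[of i] by (simp add: w_def ln_div)
    ultimately show "\<alpha> $ i * ln (- p) + \<alpha> $ i * ln (w $ i)
        = \<alpha> $ i * ln (0 - p * \<alpha> $ i) - \<alpha> $ i * ln (r $ i)"
      by (simp only: distrib_left right_diff_distrib)
  qed
  ultimately show "hpower_h \<alpha> p r 0 < 0" by simp
qed

lemma hpower_h_strict_mono:
  fixes \<alpha> r :: "real ^ 'n"
  assumes "\<And>i. 0 < \<alpha> $ i" "\<And>i. p * \<alpha> $ i < y" "y < z"
  shows "hpower_h \<alpha> p r y < hpower_h \<alpha> p r z"
proof -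
  have "ln (y - p * \<alpha> $ i) < ln (z - p * \<alpha> $ i)" for i
    using assms(2)[of i] assms(3) by (intro ln_less_cancel_iff[THEN iffD2]) auto
  then show ?thesis
    unfolding hpower_h_def using assms(1) by (intro diff_strict_right_mono sum_strict_mono) auto
qed

text \<open>
  The intermediate value theorem on \<open>[0, \<phi>(r)]\<close>: since \<open>p < 0\<close>, each \<open>\<phi>(r) - p \<alpha>\<^sub>i\<close> is at least
  \<open>\<phi>(r)\<close>, whence \<open>h(\<phi>(r)) \<ge> 0\<close>.
\<close>
lemma hpower_h_root_ex:
  fixes \<alpha> r :: "real ^ 'n"
  assumes \<alpha>: "\<And>i. 0 < \<alpha> $ i" "(\<Sum>i\<in>UNIV. \<alpha> $ i) = 1"
    and s: "(p, r) \<in> interior (dual_cone (hpower_cone \<alpha>))"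
  obtains y where "0 < y" "hpower_h \<alpha> p r y = 0"
proof -
  note p = interior_dual_hpower_coneD(1)[OF \<alpha> s] and r = interior_dual_hpower_coneD(2)[OF \<alpha> s]
    and h0 = interior_dual_hpower_coneD(3)[OF \<alpha> s]
  define Y where "Y = power_prod \<alpha> r"
  have Y: "Y > 0" unfolding Y_def by (rule power_prod_pos[OF r])
  have pa: "p * \<alpha> $ i < 0" for i using p \<alpha>(1) by (simp add: mult_neg_pos)
  have "ln Y = (\<Sum>i\<in>UNIV. \<alpha> $ i * ln Y)"
    by (simp add: \<alpha>(2) flip: sum_distrib_right)
  also have "\<dots> \<le> (\<Sum>i\<in>UNIV. \<alpha> $ i * ln (Y - p * \<alpha> $ i))"
  proof (intro sum_mono mult_left_mono)
    fix i show "ln Y \<le> ln (Y - p * \<alpha> $ i)"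
      using Y pa[of i] by (intro ln_le_cancel_iff[THEN iffD2]) auto
  qed (use \<alpha>(1) in \<open>auto intro: less_imp_le\<close>)
  finally have hY: "0 \<le> hpower_h \<alpha> p r Y"
    by (simp add: hpower_h_def Y_def)
  have "continuous_on {0..Y} (hpower_h \<alpha> p r)"
    unfolding hpower_h_def
  proof (intro continuous_intros)
    fix i show "\<forall>x\<in>{0..Y}. x - p * \<alpha> $ i \<noteq> 0"
      using pa[of i] by auto
  qed
  then obtain y where "0 \<le> y" "y \<le> Y" "hpower_h \<alpha> p r y = 0"
    using IVT'[of "hpower_h \<alpha> p r" 0 0 Y] h0 hY Y by auto
  moreover from this have "y \<noteq> 0" using h0 by auto
  ultimately show thesis using that[of y] by simp
qed

definition hpower_root :: "real ^ 'n \<Rightarrow> real \<Rightarrow> real ^ 'n \<Rightarrow> real" where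
  "hpower_root \<alpha> p r = (THE y. (\<forall>i. p * \<alpha> $ i < y) \<and> hpower_h \<alpha> p r y = 0)"

lemma hpower_h_root_unique:
  fixes \<alpha> r :: "real ^ 'n"
  assumes "\<And>i. 0 < \<alpha> $ i" "\<And>i. p * \<alpha> $ i < y" "\<And>i. p * \<alpha> $ i < z"
    and "hpower_h \<alpha> p r y = hpower_h \<alpha> p r z"
  shows "y = z"
  using hpower_h_strict_mono[of \<alpha> p y z r] hpower_h_strict_mono[of \<alpha> p z y r] assms
  by (cases y z rule: linorder_cases) auto

lemma hpower_root:
  fixes \<alpha> r :: "real ^ 'n"
  assumes \<alpha>: "\<And>i. 0 < \<alpha> $ i" "(\<Sum>i\<in>UNIV. \<alpha> $ i) = 1"
    and s: "(p, r) \<in> interior (dual_cone (hpower_cone \<alpha>))"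
  shows "0 < hpower_root \<alpha> p r" "hpower_h \<alpha> p r (hpower_root \<alpha> p r) = 0"
    and "\<And>y. (\<forall>i. p * \<alpha> $ i < y) \<Longrightarrow> hpower_h \<alpha> p r y = 0 \<Longrightarrow> y = hpower_root \<alpha> p r"
proof -
  obtain y where y: "0 < y" "hpower_h \<alpha> p r y = 0"
    using hpower_h_root_ex[OF \<alpha> s] by blast
  have py: "\<forall>i. p * \<alpha> $ i < y"
    using less_trans[OF mult_neg_pos[OF interior_dual_hpower_coneD(1)[OF \<alpha> s] \<alpha>(1)] y(1)]
    by blast
  have uniq: "z = y" if "\<forall>i. p * \<alpha> $ i < z" "hpower_h \<alpha> p r z = 0" for z
    using hpower_h_root_unique[OF \<alpha>(1), of p z y r] that py y(2) by simp
  have eq: "hpower_root \<alpha> p r = y"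
    unfolding hpower_root_def by (intro the_equality) (use py y(2) uniq in blast)+
  show "0 < hpower_root \<alpha> p r" "hpower_h \<alpha> p r (hpower_root \<alpha> p r) = 0"
    using y eq by simp_all
  show "\<And>z. (\<forall>i. p * \<alpha> $ i < z) \<Longrightarrow> hpower_h \<alpha> p r z = 0 \<Longrightarrow> z = hpower_root \<alpha> p r"
    unfolding eq by (rule uniq)
qed

text \<open>
  If \<open>0 < b < Y s < a\<close>, then \<open>h(b) < 0 < h(a)\<close> at \<open>s\<close>. For fixed \<open>a\<close> and \<open>b\<close> both signs persist
  at all nearby \<open>t\<close>, where monotonicity of \<open>h\<close> traps the root \<open>Y t\<close> between \<open>b\<close> and \<open>a\<close>. This
  does the work of an implicit function theorem.
\<close>
lemma tendsto_hpower_root: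
  fixes \<alpha> :: "real ^ 'n"
  assumes \<alpha>: "\<And>i. 0 < \<alpha> $ i" "(\<Sum>i\<in>UNIV. \<alpha> $ i) = 1"
    and s: "s \<in> interior (dual_cone (hpower_cone \<alpha>))"
  shows "((\<lambda>t. hpower_root \<alpha> (fst t) (snd t)) \<longlongrightarrow> hpower_root \<alpha> (fst s) (snd s)) (at s)"
proof -
  define Y where "Y t = hpower_root \<alpha> (fst t) (snd t)" for t :: "real \<times> (real ^ 'n)"
  define S where "S = interior (dual_cone (hpower_cone \<alpha>))"
  have root: "0 < Y t" "hpower_h \<alpha> (fst t) (snd t) (Y t) = 0" 
    and pa: "\<And>i. fst t * \<alpha> $ i < 0" and r: "\<And>i. 0 < snd t $ i" if "t \<in> S" for t
    using hpower_root(1,2)[OF \<alpha>, of "fst t" "snd t"]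
      interior_dual_hpower_coneD(1,2)[OF \<alpha>, of "fst t" "snd t"] that \<alpha>(1)
    by (auto simp: Y_def S_def mult_neg_pos)
  have sS: "s \<in> S" using s by (simp add: S_def)
  have near: "\<forall>\<^sub>F t in at s. t \<in> S"
    using eventually_at_topological open_interior sS S_def by blast
  have cont: "((\<lambda>t. hpower_h \<alpha> (fst t) (snd t) y) \<longlongrightarrow> hpower_h \<alpha> (fst s) (snd s) y) (at s)"
    if "0 < y" for y
  proof -
    have "y - fst s * \<alpha> $ i \<noteq> 0" for i using pa[OF sS, of i] that by simp
    then show ?thesis
      unfolding hpower_h_def
      using power_prod_pos[OF r[OF sS], of \<alpha>]
      by (intro tendsto_intros tendsto_power_prod r[OF sS]) auto
  qed
  have mono: "hpower_h \<alpha> (fst t) (snd t) y < hpower_h \<alpha> (fst t) (snd t) z"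
    if "t \<in> S" "0 < y" "y < z" for t y z
    using that pa[of t] \<alpha>(1) by (intro hpower_h_strict_mono) (auto intro: less_trans)
  have "(Y \<longlongrightarrow> Y s) (at s)"
  proof (rule order_tendstoI)
    fix a assume "a < Y s"
    \<comment> \<open>\<open>h\<close> is only under control at positive arguments, and \<open>a\<close> may be negative.\<close>
    then obtain b where b: "max a 0 < b" "b < Y s"
      using root(1)[OF sS] dense[of "max a 0" "Y s"] by auto
    then have "hpower_h \<alpha> (fst s) (snd s) b < 0"
      using mono[OF sS, of b "Y s"] root(2)[OF sS] by simp
    then have "\<forall>\<^sub>F t in at s. hpower_h \<alpha> (fst t) (snd t) b < 0"
      using b by (intro order_tendstoD(2)[OF cont]) auto
    with near show "\<forall>\<^sub>F t in at s. a < Y t"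
    proof eventually_elim
      case (elim t)
      then show ?case
        using b root[of t] mono[of t "Y t" b] by (cases "Y t" b rule: linorder_cases) auto
    qed
  next
    fix a assume a: "Y s < a"
    then have a0: "0 < a" using root(1)[OF sS] by simp
    have "0 < hpower_h \<alpha> (fst s) (snd s) a"
      using mono[OF sS, of "Y s" a] root[OF sS] a by simp
    then have "\<forall>\<^sub>F t in at s. 0 < hpower_h \<alpha> (fst t) (snd t) a"
      using a0 by (intro order_tendstoD(1)[OF cont]) auto
    with near show "\<forall>\<^sub>F t in at s. Y t < a"
    proof eventually_elim
      case (elim t)
      then show ?case
        using a0 root[of t] mono[of t a "Y t"] by (cases "Y t" a rule: linorder_cases) auto
    qed
  qed
  then show ?thesis unfolding Y_def .
qed

section \<open>The maximiser\<close>

text \<open>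
  The solution of the first-order conditions \<open>\<phi>(w) - u = - 1 / p\<close> and
  \<open>r\<^sub>i w\<^sub>i = 1 - p \<alpha>\<^sub>i \<phi>(w)\<close>, parametrised by \<open>y = 1 / \<phi>(w)\<close>.
\<close>
definition hpower_argmax :: "real ^ 'n \<Rightarrow> real \<times> (real ^ 'n) \<Rightarrow> real \<times> (real ^ 'n)" where
  "hpower_argmax \<alpha> = (\<lambda>(p, r). let y = hpower_root \<alpha> p r
    in (inverse y + inverse p, \<chi> i. (1 - p * \<alpha> $ i * inverse y) / r $ i))"

lemma tendsto_hpower_argmax:
  fixes \<alpha> :: "real ^ 'n"
  assumes \<alpha>: "\<And>i. 0 < \<alpha> $ i" "(\<Sum>i\<in>UNIV. \<alpha> $ i) = 1"
    and s: "s \<in> interior (dual_cone (hpower_cone \<alpha>))"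
  shows "(hpower_argmax \<alpha> \<longlongrightarrow> hpower_argmax \<alpha> s) (at s)"
proof -
  obtain p r where pr: "s = (p, r)" by (cases s)
  have nz: "fst s \<noteq> 0" "\<And>i. snd s $ i \<noteq> 0" "hpower_root \<alpha> (fst s) (snd s) \<noteq> 0"
    using interior_dual_hpower_coneD(1,2)[OF \<alpha> s[unfolded pr]] hpower_root(1)[OF \<alpha> s[unfolded pr]]
    by (auto simp: pr less_imp_neq[THEN not_sym])
  show ?thesis
    unfolding hpower_argmax_def case_prod_unfold Let_def using nz
    by (intro tendsto_intros tendsto_vec_lambda tendsto_hpower_root[OF assms])
qed

text \<open>
  The condition that makes the parametrisation consistent: the weights sum to \<open>1\<close>, so the
  logarithm of the left-hand side is \<open>h(y) - ln y\<close>.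
\<close>
lemma hpower_root_reciprocal:
  fixes \<alpha> r :: "real ^ 'n"
  assumes \<alpha>: "(\<Sum>i\<in>UNIV. \<alpha> $ i) = 1"
    and r: "\<And>i. 0 < r $ i" and y: "0 < y" "\<And>i. p * \<alpha> $ i < y" "hpower_h \<alpha> p r y = 0"
  shows "power_prod \<alpha> (\<chi> i. (1 - p * \<alpha> $ i * inverse y) / r $ i) = inverse y"
proof -
  let ?w = "\<chi> i. (1 - p * \<alpha> $ i * inverse y) / r $ i"
  have eq: "?w $ i = (y - p * \<alpha> $ i) / (y * r $ i)" for i
    using y(1) r[of i] by (simp add: field_simps)
  have w: "0 < ?w $ i" for i
    unfolding eq using y(1) y(2)[of i] r[of i] by simp
  have "ln (?w $ i) = ln (y - p * \<alpha> $ i) - ln (r $ i) - ln y" for i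
    unfolding eq using y(1) y(2)[of i] r[of i] by (simp add: ln_div ln_mult)
  then have "ln (power_prod \<alpha> ?w) = (\<Sum>i\<in>UNIV. \<alpha> $ i * (ln (y - p * \<alpha> $ i) - ln (r $ i) - ln y))"
    unfolding ln_power_prod[OF w] by simp
  also have "\<dots> = hpower_h \<alpha> p r y - (\<Sum>i\<in>UNIV. \<alpha> $ i) * ln y"
    unfolding hpower_h_def ln_power_prod[OF r] sum_distrib_right sum_subtractf[symmetric]
    by (simp add: algebra_simps)
  also have "\<dots> = ln (inverse y)" using y(1,3) \<alpha> by (simp add: ln_inverse)
  finally show ?thesis using power_prod_pos[OF w, of \<alpha>] y(1) by simp
qed

text \<open>
  Let \<open>(u\<^sub>0, w\<^sub>0)\<close> be the critical point and \<open>z = \<phi>(w) - u\<close>. The tangent of \<open>ln\<close> at \<open>- 1 / p\<close>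
  bounds \<open>ln z\<close> by a function with slope \<open>- p\<close>, which cancels the \<open>z\<close> in \<open>- p u = - p \<phi>(w) + p z\<close>.
  With \<open>t\<^sub>i = w\<^sub>i / w\<^sub>0\<^sub>i\<close>, the tangent bounds of \<open>ln w\<^sub>i\<close> contribute \<open>\<Sum> t\<^sub>i\<close>, the mean inequality
  bounds \<open>- p \<phi>(w)\<close> by \<open>- (p / y) \<Sum> \<alpha>\<^sub>i t\<^sub>i\<close>, and the first-order conditions say that
  \<open>\<langle>r, w\<rangle>\<close> is the sum of these two. What remains is the constant \<open>C\<close>, the value at
  \<open>(u\<^sub>0, w\<^sub>0)\<close>.
\<close>
lemma hpower_argmax_maximal:
  fixes \<alpha> :: "real ^ 'n"
  assumes \<alpha>: "\<And>i. 0 < \<alpha> $ i" "(\<Sum>i\<in>UNIV. \<alpha> $ i) = 1"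
    and s: "s \<in> interior (dual_cone (hpower_cone \<alpha>))"
  shows "hpower_argmax \<alpha> s \<in> interior (hpower_cone \<alpha>)"
    and "x \<in> interior (hpower_cone \<alpha>) \<Longrightarrow> - (s \<bullet> x) - hpower_barrier \<alpha> x
      \<le> - (s \<bullet> hpower_argmax \<alpha> s) - hpower_barrier \<alpha> (hpower_argmax \<alpha> s)"
proof -
  obtain p r where pr: "s = (p, r)" by (cases s)
  note s' = s[unfolded pr]
  note p = interior_dual_hpower_coneD(1)[OF \<alpha> s'] and r = interior_dual_hpower_coneD(2)[OF \<alpha> s']
  define y where "y = hpower_root \<alpha> p r"
  define w0 where "w0 = (\<chi> i. (1 - p * \<alpha> $ i * inverse y) / r $ i)"
  have y: "0 < y" "hpower_h \<alpha> p r y = 0"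
    using hpower_root[OF \<alpha> s'] by (simp_all add: y_def)
  have py: "p * \<alpha> $ i < 0" for i using p \<alpha>(1)[of i] by (simp add: mult_neg_pos)
  have x0: "hpower_argmax \<alpha> s = (inverse y + inverse p, w0)"
    by (simp add: hpower_argmax_def pr y_def w0_def Let_def)
  have \<phi>: "power_prod \<alpha> w0 = inverse y"
    unfolding w0_def using hpower_root_reciprocal[OF \<alpha>(2) r y(1) _ y(2)] less_trans[OF py y(1)]
    by simp
  have rw: "r $ i * w0 $ i = 1 - p * \<alpha> $ i * inverse y" for i
    using r[of i] by (simp add: w0_def)
  have w0: "0 < w0 $ i" for i
    using r[of i] py[of i] y(1) mult_neg_pos[of "p * \<alpha> $ i" "inverse y"]
    unfolding w0_def by simp
  show "hpower_argmax \<alpha> s \<in> interior (hpower_cone \<alpha>)"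
    unfolding x0 using w0 p by (intro interior_hpower_coneI) (auto simp: \<phi>)
  define C where "C = ln (- inverse p) - 1 + (\<Sum>i\<in>UNIV. ln (w0 $ i) - 1)"
  have "r \<bullet> w0 = (\<Sum>i\<in>UNIV. 1 - \<alpha> $ i * (p * inverse y))"
    unfolding inner_vec_def by (simp add: rw mult_ac)
  also have "\<dots> = (\<Sum>i\<in>(UNIV :: 'n set). 1) - p * inverse y"
    by (simp add: sum_subtractf \<alpha>(2) flip: sum_distrib_right)
  finally have at_x0: "- (s \<bullet> hpower_argmax \<alpha> s) - hpower_barrier \<alpha> (hpower_argmax \<alpha> s) = C"
    using p unfolding C_def sum_subtractf x0
    by (simp add: pr hpower_barrier_def \<phi> algebra_simps)
  assume x: "x \<in> interior (hpower_cone \<alpha>)"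
  obtain u w where uw: "x = (u, w)" by (cases x)
  have I: "u < power_prod \<alpha> w" "\<And>i. 0 < w $ i"
    using interior_hpower_coneD x uw by blast+
  define z where "z = power_prod \<alpha> w - u"
  have z: "ln z \<le> ln (- inverse p) - p * z - 1"
  proof -
    have "0 < z" using I(1) by (simp add: z_def)
    then have "ln (- p) + ln z \<le> - p * z - 1"
      using ln_le_minus_one[of "- p * z"] p ln_mult[of "- p" z] by (simp add: mult_neg_pos)
    moreover have "ln (- inverse p) = - ln (- p)"
      using p ln_inverse[of "- p"] by simp
    ultimately show ?thesis by simp
  qed
  define t where "t = (\<chi> i. w $ i / w0 $ i)"
  have t: "0 < t $ i" for i using I(2) w0 by (simp add: t_def)
  have lnw: "ln (w $ i) \<le> ln (w0 $ i) - 1 + t $ i" for i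
    using ln_le_minus_one[OF t[of i]] I(2)[of i] w0[of i] by (simp add: t_def ln_div)
  have w_eq: "w $ i = t $ i * w0 $ i" for i
    using w0[of i] by (simp add: t_def)
  have "power_prod \<alpha> w = power_prod \<alpha> t * inverse y"
    unfolding \<phi>[symmetric] power_prod_def prod.distrib[symmetric]
    by (intro prod.cong refl) (simp add: w_eq powr_mult)
  also have "\<dots> \<le> (\<Sum>i\<in>UNIV. \<alpha> $ i * t $ i) * inverse y"
    using power_prod_le_weighted_sum[OF \<alpha> t] y(1) by (intro mult_right_mono) auto
  finally have "- p * power_prod \<alpha> w \<le> - p * ((\<Sum>i\<in>UNIV. \<alpha> $ i * t $ i) * inverse y)"
    using p by (intro mult_left_mono) auto
  also have "\<dots> = (\<Sum>i\<in>UNIV. - (p * \<alpha> $ i * inverse y * t $ i))"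
    by (simp add: sum_distrib_left sum_distrib_right mult_ac sum_negf)
  finally have \<phi>w: "- p * power_prod \<alpha> w \<le> (\<Sum>i\<in>UNIV. - (p * \<alpha> $ i * inverse y * t $ i))" .
  have "(\<Sum>i\<in>UNIV. ln (w $ i)) \<le> (\<Sum>i\<in>UNIV. ln (w0 $ i) - 1 + t $ i)"
    by (intro sum_mono lnw)
  also have "\<dots> = (\<Sum>i\<in>UNIV. ln (w0 $ i) - 1) + (\<Sum>i\<in>UNIV. t $ i)"
    by (simp add: sum.distrib)
  finally have lnws: "(\<Sum>i\<in>UNIV. ln (w $ i)) \<le> (\<Sum>i\<in>UNIV. ln (w0 $ i) - 1) + (\<Sum>i\<in>UNIV. t $ i)" .
  have "r $ i * w $ i = t $ i - p * \<alpha> $ i * inverse y * t $ i" for i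
    unfolding w_eq using rw[of i] by (metis left_diff_distrib mult.assoc mult.commute mult_1)
  then have cancel: "r \<bullet> w = (\<Sum>i\<in>UNIV. t $ i) + (\<Sum>i\<in>UNIV. - (p * \<alpha> $ i * inverse y * t $ i))"
    unfolding inner_vec_def sum.distrib[symmetric] by simp
  have "- (s \<bullet> x) - hpower_barrier \<alpha> x
      = - p * power_prod \<alpha> w + p * z - r \<bullet> w + ln z + (\<Sum>i\<in>UNIV. ln (w $ i))"
    by (simp add: pr uw hpower_barrier_def z_def algebra_simps)
  also have "\<dots> \<le> C"
    using \<phi>w z lnws unfolding cancel C_def by linarith
  finally show "- (s \<bullet> x) - hpower_barrier \<alpha> x
      \<le> - (s \<bullet> hpower_argmax \<alpha> s) - hpower_barrier \<alpha> (hpower_argmax \<alpha> s)"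
    unfolding at_x0 .
qed

section \<open>The conjugate gradient of the hypograph power cone\<close>

lemma hpower_root_equal_exponents:
  fixes \<alpha> r :: "real ^ 'n"
  assumes \<alpha>: "\<And>i. 0 < \<alpha> $ i" "(\<Sum>i\<in>UNIV. \<alpha> $ i) = 1"
    and s: "(p, r) \<in> interior (dual_cone (hpower_cone \<alpha>))"
    and eq: "\<And>i. \<alpha> $ i = 1 / real CARD('n)"
  shows "hpower_root \<alpha> p r = power_prod \<alpha> r + p / real CARD('n)"
proof (rule hpower_root(3)[OF \<alpha> s, symmetric])
  have "power_prod \<alpha> r > 0"
    using power_prod_pos interior_dual_hpower_coneD(2)[OF \<alpha> s] .
  then show "\<forall>i. p * \<alpha> $ i < power_prod \<alpha> r + p / real CARD('n)"
    by (simp add: eq)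
  show "hpower_h \<alpha> p r (power_prod \<alpha> r + p / real CARD('n)) = 0"
    by (simp add: hpower_h_def eq)
qed

theorem proposition3p3:
  fixes \<alpha> r :: "real ^ 'n" and p :: real
  assumes "\<And>i. 0 < \<alpha> $ i"
    and "(\<Sum>i\<in>UNIV. \<alpha> $ i) = 1"
    and "(p, r) \<in> interior (dual_cone (hpower_cone \<alpha>))"
  defines "g \<equiv> conj_gradient (hpower_cone \<alpha>) (hpower_barrier \<alpha>) (p, r)"
  shows "(GDERIV (conj_barrier (hpower_cone \<alpha>) (hpower_barrier \<alpha>)) (p, r) :> g) \<and>
    (\<exists>!y. Max (range (\<lambda>i. p * \<alpha> $ i)) < y \<and> hpower_h \<alpha> p r y = 0) \<and>
    (\<forall>y. Max (range (\<lambda>i. p * \<alpha> $ i)) < y \<and> hpower_h \<alpha> p r y = 0 \<longrightarrow>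
      fst g = - inverse p - inverse y \<and>
      (\<forall>i. snd g $ i = (p * \<alpha> $ i * inverse y - 1) / r $ i)) \<and>
    ((\<forall>i. \<alpha> $ i = 1 / real CARD('n)) \<longrightarrow>
      fst g = - inverse p - inverse (power_prod \<alpha> r + p / real CARD('n)) \<and>
      (\<forall>i. snd g $ i =
        - (power_prod \<alpha> r / (r $ i * (power_prod \<alpha> r + p / real CARD('n))))))"
proof -
  note \<alpha> = assms(1,2) and s = assms(3)
  define y where "y = hpower_root \<alpha> p r"
  have p: "p < 0" and r: "\<And>i. 0 < r $ i"
    using interior_dual_hpower_coneD[OF \<alpha> s] by auto
  have y: "0 < y" "hpower_h \<alpha> p r y = 0"
    using hpower_root[OF \<alpha> s] by (simp_all add: y_def)
  have Max_iff: "Max (range (\<lambda>i. p * \<alpha> $ i)) < z \<longleftrightarrow> (\<forall>i. p * \<alpha> $ i < z)" for z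
    by (subst Max_less_iff) auto
  have py: "\<forall>i. p * \<alpha> $ i < y"
    using less_trans[OF mult_neg_pos[OF p \<alpha>(1)] y(1)] by blast
  have roots: "(\<forall>i. p * \<alpha> $ i < z) \<and> hpower_h \<alpha> p r z = 0 \<longleftrightarrow> z = y" for z
    using hpower_root(3)[OF \<alpha> s, of z, folded y_def] y(2) py by blast
  have grad: "GDERIV (conj_barrier (hpower_cone \<alpha>) (hpower_barrier \<alpha>)) (p, r) :>
      - hpower_argmax \<alpha> (p, r)"
    by (rule GDERIV_conj_barrier[OF open_interior s])
       (use hpower_argmax_maximal[OF \<alpha>] tendsto_hpower_argmax[OF \<alpha> s] in auto)
  then have g: "g = - hpower_argmax \<alpha> (p, r)"
    unfolding g_def by (rule conj_gradient_eq)
  have fst_g: "fst g = - inverse p - inverse y"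
    by (simp add: g hpower_argmax_def y_def Let_def)
  have snd_g: "snd g $ i = (p * \<alpha> $ i * inverse y - 1) / r $ i" for i
    by (simp add: g hpower_argmax_def y_def Let_def diff_divide_distrib)
  have equal: "fst g = - inverse p - inverse (power_prod \<alpha> r + p / real CARD('n)) \<and>
      (\<forall>i. snd g $ i =
        - (power_prod \<alpha> r / (r $ i * (power_prod \<alpha> r + p / real CARD('n)))))"
    if eq: "\<forall>i. \<alpha> $ i = 1 / real CARD('n)"
  proof -
    have y_eq: "y = power_prod \<alpha> r + p / real CARD('n)"
      unfolding y_def using hpower_root_equal_exponents[OF \<alpha> s] eq by blast
    have "snd g $ i = - (power_prod \<alpha> r / (r $ i * y))" for i
    proof -
      have pa: "p * \<alpha> $ i = y - power_prod \<alpha> r" using eq y_eq by simp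
      show ?thesis unfolding snd_g pa using y(1) r[of i] by (simp add: field_simps)
    qed
    then show ?thesis using fst_g by (simp add: y_eq)
  qed
  have ex1: "\<exists>!z. z = y" by simp
  have formulas: "\<forall>z. z = y \<longrightarrow> fst g = - inverse p - inverse z \<and>
      (\<forall>i. snd g $ i = (p * \<alpha> $ i * inverse z - 1) / r $ i)"
    using fst_g snd_g by simp
  show ?thesis
    unfolding Max_iff roots
    by (intro conjI[OF grad[folded g] conjI[OF ex1 conjI[OF formulas impI]]] equal)
qed

end
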